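(* The function $g$ satisfies $$g(Z(s),\sigma,\rho)=\frac{Z(s)}{1+g(Z(\sigma s),\rho,\sigma)} .$$ (Note that $\sigma$ and $\rho$ are exchanged on the right-hand side.)
   Context: Continued fractions are written $$[a_1,\ldots,a_k]=\cfrac{a_1}{1+\cfrac{a_2}{1+\cdots+\cfrac{a_{k-1}}{1+a_k}}},$$ so that $[a_1,a_2,\ldots,a_k]=[a_1,[a_2,\ldots,a_k]]$ with $[a,b]=\frac{a}{1+b}$; a bracket with infinitely many entries denotes the corresponding infinite continued fraction. The constants $\sigma,\rho$ are the scaling constants of a fractal Cauer type RC network, i.e. a ladder network with resistances and capacitances satisfying $R(k+1)=\sigma R(k)$, $C(k+1)=\rho C(k)$. With $R_1=R(1)$ and $C_1=C(1)$, put $Z(s)=\frac{1}{sR_1C_1}$, where $s$ is the Laplace variable. The function $g$ is $$g(z,\sigma,\rho)=\big[z,\ z\sigma^{-1},\ z(\sigma\rho)^{-1},\ z(\sigma^2\rho)^{-1},\ z(\sigma^2\rho^2)^{-1},\ \ldots\big],$$ the entries being, in order, $z(\sigma\rho)^{-n},\ z\sigma^{-1}(\sigma\rho)^{-n}$ for $n=0,1,2,\ldots$. The transfer function of the network is $H(s,\sigma,\rho)=[R_1^{-1},g(Z(s),\sigma,\rho)]$. *)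

theory Defs
  imports "HOL-Analysis.Analysis"
begin

text \<open>
  Values of continued fractions lie in the Riemann sphere: \<open>Some w\<close> is the finite value \<open>w\<close>,
  \<open>None\<close> is the point at infinity. So an approximant with vanishing denominator is infinite (a
  pole), instead of \<open>0\<close> as division by zero in type \<^typ>\<open>complex\<close> would give.
\<close>

type_synonym sphere = "complex option"

abbreviation sphere_topology :: "sphere topology" where
  "sphere_topology \<equiv> Alexandroff_compactification (euclidean :: complex topology)"

definition sphere_add :: "complex \<Rightarrow> sphere \<Rightarrow> sphere" where
  "sphere_add c w = map_option ((+) c) w"

text \<open>Division of \<open>c\<close> by a point of the sphere; meant for \<open>c \<noteq> 0\<close> (the quotient \<open>0 / 0\<close> is
  indeterminate).\<close>

definition sphere_divide :: "complex \<Rightarrow> sphere \<Rightarrow> sphere" where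
  "sphere_divide c w =
     (case w of None \<Rightarrow> Some 0 | Some b \<Rightarrow> if b = 0 then None else Some (c / b))"

text \<open>The finite bracket \<open>[a\<^sub>1, \<dots>, a\<^sub>k]\<close>. The empty bracket is \<open>0\<close>, so that
  \<open>[a] = a / (1 + 0) = a\<close>.\<close>

fun bracket :: "complex list \<Rightarrow> sphere" where
  "bracket [] = Some 0"
| "bracket (a # as) = sphere_divide a (sphere_add 1 (bracket as))"

text \<open>The infinite bracket \<open>[a 0, a 1, a 2, \<dots>]\<close> is the limit in the sphere of its approximants
  \<open>[a 0, \<dots>, a (n - 1)]\<close>. Limits are unique since the sphere is Hausdorff; the value is
  unspecified for a divergent continued fraction.\<close>

definition cfrac_has_value :: "(nat \<Rightarrow> complex) \<Rightarrow> sphere \<Rightarrow> bool" where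
  "cfrac_has_value a v \<longleftrightarrow>
     limitin sphere_topology (\<lambda>n. bracket (map a [0..<n])) v sequentially"

definition cfrac_convergent :: "(nat \<Rightarrow> complex) \<Rightarrow> bool" where
  "cfrac_convergent a \<longleftrightarrow> (\<exists>v. cfrac_has_value a v)"

definition cfrac_value :: "(nat \<Rightarrow> complex) \<Rightarrow> sphere" where
  "cfrac_value a = (THE v. cfrac_has_value a v)"

text \<open>The entries \<open>z, z \<sigma>\<^sup>-\<^sup>1, z (\<sigma>\<rho>)\<^sup>-\<^sup>1, z \<sigma>\<^sup>-\<^sup>1 (\<sigma>\<rho>)\<^sup>-\<^sup>1, \<dots>\<close>, numbered from \<open>0\<close>.\<close>

definition g_entry :: "complex \<Rightarrow> real \<Rightarrow> real \<Rightarrow> nat \<Rightarrow> complex" where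
  "g_entry z \<sigma> \<rho> k =
     (if even k then z / of_real ((\<sigma> * \<rho>) ^ (k div 2))
      else z / of_real (\<sigma> * (\<sigma> * \<rho>) ^ (k div 2)))"

definition g_convergent :: "complex \<Rightarrow> real \<Rightarrow> real \<Rightarrow> bool" where
  "g_convergent z \<sigma> \<rho> \<longleftrightarrow> cfrac_convergent (g_entry z \<sigma> \<rho>)"

definition g :: "complex \<Rightarrow> real \<Rightarrow> real \<Rightarrow> sphere" where
  "g z \<sigma> \<rho> = cfrac_value (g_entry z \<sigma> \<rho>)"

text \<open>Components are numbered from \<open>1\<close>. Positivity of resistances and capacitances forces
  \<open>\<sigma> > 0\<close> and \<open>\<rho> > 0\<close>.\<close>

definition fractal_cauer_RC ::
    "(nat \<Rightarrow> real) \<Rightarrow> (nat \<Rightarrow> real) \<Rightarrow> real \<Rightarrow> real \<Rightarrow> bool" where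
  "fractal_cauer_RC R C \<sigma> \<rho> \<longleftrightarrow>
     (\<forall>k\<ge>1. R k > 0 \<and> C k > 0 \<and> R (Suc k) = \<sigma> * R k \<and> C (Suc k) = \<rho> * C k)"

definition Z :: "real \<Rightarrow> real \<Rightarrow> complex \<Rightarrow> complex" where
  "Z R\<^sub>1 C\<^sub>1 s = 1 / (s * of_real R\<^sub>1 * of_real C\<^sub>1)"

end

theory Submission
  imports Defs
begin

text \<open>
  Removing the first entry of \<open>g_entry z \<sigma> \<rho>\<close> leaves \<open>g_entry (z / \<sigma>) \<rho> \<sigma>\<close>, so consecutive
  approximants are related by the Moebius map \<open>w \<mapsto> z / (1 + w)\<close>. For \<open>z \<noteq> 0\<close> this is a
  homeomorphism of the Riemann sphere, with inverse \<open>v \<mapsto> z / v - 1\<close>, and thus transports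
  convergence and limits in both directions.
\<close>

text \<open>Every neighbourhood of a finite point contains an open set of finite points: a
  neighbourhood of infinity omits only a compact, hence closed, set. So near \<open>Some w\<close>
  the sphere looks like the complex plane.\<close>

lemma limitin_sphere_Some:
  "limitin sphere_topology f (Some w) F \<longleftrightarrow>
     (\<forall>\<^sub>F x in F. f x \<noteq> None) \<and> ((\<lambda>x. the (f x)) \<longlongrightarrow> w) F" (is "?L \<longleftrightarrow> ?R")
proof
  assume L: ?L
  have ev: "\<forall>\<^sub>F x in F. f x \<in> Some ` U" if "open U" "w \<in> U" for U
    using L that by (auto simp: limitin_def openin_Alexandroff_compactification)
  have "\<forall>\<^sub>F x in F. f x \<noteq> None"
    by (rule eventually_mono [OF ev [of UNIV]]) auto
  moreover have "((\<lambda>x. the (f x)) \<longlongrightarrow> w) F"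
  proof (rule topological_tendstoI)
    fix U assume "open U" "w \<in> U"
    from ev [OF this] show "\<forall>\<^sub>F x in F. the (f x) \<in> U"
      by (rule eventually_mono) auto
  qed
  ultimately show ?R ..
next
  assume R: ?R
  have "\<forall>\<^sub>F x in F. f x \<in> V" if V: "openin sphere_topology V" and w: "Some w \<in> V" for V
  proof -
    obtain U where U: "open U" "w \<in> U" "Some ` U \<subseteq> V"
    proof -
      from V consider U where "open U" "V = Some ` U"
        | K where "compact K" "V = insert None (Some ` (- K))"
        by (auto simp: openin_Alexandroff_compactification Compl_eq_Diff_UNIV)
      then show thesis
      proof cases
        case 1
        with w that show thesis by blast
      next
        case 2
        with w that [of "- K"] show thesis by (auto dest: compact_imp_closed simp: open_Compl)
      qed
    qed
    have "\<forall>\<^sub>F x in F. the (f x) \<in> U"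
      using R U by (blast dest: topological_tendstoD)
    with R have "\<forall>\<^sub>F x in F. f x \<noteq> None \<and> the (f x) \<in> U"
      by (simp add: eventually_conj_iff)
    then show ?thesis
      by (rule eventually_mono) (use U(3) in force)
  qed
  then show ?L by (simp add: limitin_def)
qed

text \<open>Compact sets are bounded, so complements of closed balls form a neighbourhood base at
  infinity. Values \<open>None\<close> lie in all of these and meet the condition vacuously.\<close>

lemma limitin_sphere_None:
  "limitin sphere_topology f None F \<longleftrightarrow>
     (\<forall>B. \<forall>\<^sub>F x in F. \<forall>w. f x = Some w \<longrightarrow> B < norm w)" (is "?L \<longleftrightarrow> ?R")
proof
  assume L: ?L
  show ?R
  proof
    fix B
    have "openin sphere_topology (insert None (Some ` (- cball 0 B)))"
      unfolding openin_Alexandroff_compactification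
      by (intro disjI2 exI [of _ "cball 0 B"]) (simp add: Compl_eq_Diff_UNIV)
    with L have "\<forall>\<^sub>F x in F. f x \<in> insert None (Some ` (- cball 0 B))"
      unfolding limitin_def by blast
    then show "\<forall>\<^sub>F x in F. \<forall>w. f x = Some w \<longrightarrow> B < norm w"
      by (rule eventually_mono) auto
  qed
next
  assume R: ?R
  have "\<forall>\<^sub>F x in F. f x \<in> V" if V: "openin sphere_topology V" and None: "None \<in> V" for V
  proof -
    from V None obtain K where K: "compact K" "V = insert None (Some ` (- K))"
      by (auto simp: openin_Alexandroff_compactification Compl_eq_Diff_UNIV)
    obtain B where B: "\<And>w. w \<in> K \<Longrightarrow> norm w \<le> B"
      using compact_imp_bounded [OF K(1)] by (auto simp: bounded_iff)
    have "\<forall>\<^sub>F x in F. \<forall>w. f x = Some w \<longrightarrow> B < norm w"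
      using R by blast
    then show ?thesis
    proof (rule eventually_mono)
      fix x assume "\<forall>w. f x = Some w \<longrightarrow> B < norm w"
      then show "f x \<in> V"
        using B K(2) by (cases "f x") force+
    qed
  qed
  then show ?L by (simp add: limitin_def)
qed

lemma limitin_sphere_add:
  assumes "limitin sphere_topology f v F"
  shows "limitin sphere_topology (\<lambda>x. sphere_add c (f x)) (sphere_add c v) F"
proof (cases v)
  case None
  \<comment> \<open>The surplus \<open>norm c\<close> absorbs the translation, since
    \<open>norm (c + u)\<close> is at least \<open>norm u - norm c\<close>.\<close>
  with assms have ev: "\<forall>\<^sub>F x in F. \<forall>w. f x = Some w \<longrightarrow> B + norm c < norm w" for B
    by (simp add: limitin_sphere_None)
  have "\<forall>\<^sub>F x in F. \<forall>w. sphere_add c (f x) = Some w \<longrightarrow> B < norm w" for B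
  proof (rule eventually_mono [OF ev], intro allI impI)
    fix x w
    assume *: "\<forall>w. f x = Some w \<longrightarrow> B + norm c < norm w" and "sphere_add c (f x) = Some w"
    then obtain u where u: "f x = Some u" "w = c + u"
      by (auto simp: sphere_add_def)
    have "norm u \<le> norm w + norm c"
      using norm_triangle_ineq4 [of w c] u by simp
    with * u show "B < norm w" by force
  qed
  with None show ?thesis by (simp add: limitin_sphere_None sphere_add_def)
next
  case (Some w)
  with assms have ev: "\<forall>\<^sub>F x in F. f x \<noteq> None" and lim: "((\<lambda>x. the (f x)) \<longlongrightarrow> w) F"
    by (simp_all add: limitin_sphere_Some)
  have "((\<lambda>x. c + the (f x)) \<longlongrightarrow> c + w) F"
    by (intro tendsto_intros lim)
  moreover have "\<forall>\<^sub>F x in F. c + the (f x) = the (sphere_add c (f x))"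
    using ev by (rule eventually_mono) (auto simp: sphere_add_def)
  ultimately have "((\<lambda>x. the (sphere_add c (f x))) \<longlongrightarrow> c + w) F"
    by (rule Lim_transform_eventually)
  with Some ev show ?thesis by (simp add: limitin_sphere_Some sphere_add_def)
qed

text \<open>The cases are the limits infinity, zero and finite nonzero. With \<open>c = 0\<close>
  continuity fails at zero, where the value jumps from \<open>Some 0\<close> to
  \<open>None\<close>.\<close>

lemma limitin_sphere_divide:
  assumes "limitin sphere_topology f v F" and "c \<noteq> 0"
  shows "limitin sphere_topology (\<lambda>x. sphere_divide c (f x)) (sphere_divide c v) F"
proof (cases v)
  case None
  with assms have ev: "\<forall>\<^sub>F x in F. \<forall>w. f x = Some w \<longrightarrow> B < norm w" for B
    by (simp add: limitin_sphere_None)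
  have "\<forall>\<^sub>F x in F. sphere_divide c (f x) \<noteq> None"
    \<comment> \<open>The bound \<open>0\<close> excludes \<open>Some 0\<close>, the only point with
      an infinite quotient.\<close>
    by (rule eventually_mono [OF ev [of 0]])
      (auto simp: sphere_divide_def split: option.split)
  moreover have "((\<lambda>x. the (sphere_divide c (f x))) \<longlongrightarrow> 0) F"
  proof (rule tendstoI)
    fix e :: real assume "e > 0"
    show "\<forall>\<^sub>F x in F. dist (the (sphere_divide c (f x))) 0 < e"
    proof (rule eventually_mono [OF ev [of "norm c / e"]])
      fix x assume *: "\<forall>w. f x = Some w \<longrightarrow> norm c / e < norm w"
      show "dist (the (sphere_divide c (f x))) 0 < e"
      proof (cases "f x")
        case None
        with \<open>e > 0\<close> show ?thesis by (simp add: sphere_divide_def)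
      next
        case (Some w)
        with * have less: "norm c / e < norm w" by simp
        moreover have "0 < norm c / e" using \<open>e > 0\<close> assms(2) by simp
        ultimately have "norm w > 0" by linarith
        with less \<open>e > 0\<close> Some show ?thesis
          by (auto simp: sphere_divide_def norm_divide field_simps)
      qed
    qed
  qed
  ultimately show ?thesis
    using None by (simp add: limitin_sphere_Some sphere_divide_def)
next
  case (Some w)
  with assms have ev: "\<forall>\<^sub>F x in F. f x \<noteq> None" and lim: "((\<lambda>x. the (f x)) \<longlongrightarrow> w) F"
    by (simp_all add: limitin_sphere_Some)
  show ?thesis
  proof (cases "w = 0")
    case True
    have "\<forall>\<^sub>F x in F. \<forall>u. sphere_divide c (f x) = Some u \<longrightarrow> B < norm u" for B
    proof -
      \<comment> \<open>Using \<open>\<bar>B\<bar> + 1\<close> instead of \<open>B\<close> keeps the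
        radius positive for every real \<open>B\<close>. Within this radius a quotient is infinite
        or has norm above \<open>\<bar>B\<bar> + 1\<close>.\<close>
      have "0 < norm c / (\<bar>B\<bar> + 1)" using assms(2) by simp
      from tendstoD [OF lim this]
      have "\<forall>\<^sub>F x in F. norm (the (f x)) < norm c / (\<bar>B\<bar> + 1)"
        using True by simp
      with ev have "\<forall>\<^sub>F x in F. f x \<noteq> None \<and> norm (the (f x)) < norm c / (\<bar>B\<bar> + 1)"
        by (simp add: eventually_conj_iff)
      then show ?thesis
      proof (rule eventually_mono, intro allI impI)
        fix x u
        assume *: "f x \<noteq> None \<and> norm (the (f x)) < norm c / (\<bar>B\<bar> + 1)"
          and "sphere_divide c (f x) = Some u"
        then obtain b where b: "f x = Some b" "b \<noteq> 0" "u = c / b"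
          by (auto simp: sphere_divide_def split: if_splits)
        moreover have "0 < \<bar>B\<bar> + 1" by simp
        ultimately have "\<bar>B\<bar> + 1 < norm u"
          using * by (simp add: norm_divide pos_less_divide_eq mult.commute)
        then show "B < norm u" by linarith
      qed
    qed
    with Some True show ?thesis by (simp add: limitin_sphere_None sphere_divide_def)
  next
    case False
    \<comment> \<open>Away from zero and infinity \<open>sphere_divide\<close> is ordinary division,
      so the limit law for complex quotients applies.\<close>
    have "\<forall>\<^sub>F x in F. the (f x) \<noteq> 0"
      using lim False by (rule tendsto_imp_eventually_ne)
    with ev have ev': "\<forall>\<^sub>F x in F. sphere_divide c (f x) = Some (c / the (f x))"
      by eventually_elim (auto simp: sphere_divide_def)
    have "((\<lambda>x. c / the (f x)) \<longlongrightarrow> c / w) F"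
      by (intro tendsto_intros lim False)
    moreover have "\<forall>\<^sub>F x in F. c / the (f x) = the (sphere_divide c (f x))"
      using ev' by (rule eventually_mono) simp
    ultimately have "((\<lambda>x. the (sphere_divide c (f x))) \<longlongrightarrow> c / w) F"
      by (rule Lim_transform_eventually)
    moreover have "\<forall>\<^sub>F x in F. sphere_divide c (f x) \<noteq> None"
      using ev' by (rule eventually_mono) simp
    ultimately show ?thesis
      using Some False by (simp add: limitin_sphere_Some sphere_divide_def)
  qed
qed

lemma sphere_add_minus [simp]: "sphere_add (- c) (sphere_add c w) = w"
  by (cases w) (simp_all add: sphere_add_def)

lemma sphere_add_minus' [simp]: "sphere_add c (sphere_add (- c) w) = w"
  by (cases w) (simp_all add: sphere_add_def)

lemma sphere_divide_divide [simp]: "c \<noteq> 0 \<Longrightarrow> sphere_divide c (sphere_divide c w) = w"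
  by (cases w) (auto simp: sphere_divide_def)

lemma limitin_moebius_iff:
  assumes "c \<noteq> 0"
  shows "limitin sphere_topology (\<lambda>x. sphere_divide c (sphere_add 1 (f x)))
           (sphere_divide c (sphere_add 1 v)) F \<longleftrightarrow> limitin sphere_topology f v F"
proof
  assume "limitin sphere_topology (\<lambda>x. sphere_divide c (sphere_add 1 (f x)))
            (sphere_divide c (sphere_add 1 v)) F"
  \<comment> \<open>Dividing \<open>c\<close> by the image undoes the division, and adding
    \<open>- 1\<close> then undoes the translation; both inverse maps are continuous as
    well.\<close>
  from limitin_sphere_add [OF limitin_sphere_divide [OF this assms], of "- 1"]
  show "limitin sphere_topology f v F"
    using assms by simp
qed (intro limitin_sphere_add limitin_sphere_divide assms)

text \<open>The approximant with \<open>n + 1\<close> entries is the Moebius image of the tail's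
  approximant with \<open>n\<close> entries, and shifting the index by one does not affect
  limits.\<close>

lemma cfrac_has_value_Suc_iff:
  assumes "a 0 \<noteq> 0"
  shows "cfrac_has_value a (sphere_divide (a 0) (sphere_add 1 v)) \<longleftrightarrow>
         cfrac_has_value (\<lambda>k. a (Suc k)) v"
proof -
  let ?T = "\<lambda>w. sphere_divide (a 0) (sphere_add 1 w)"
  have "cfrac_has_value a (?T v) \<longleftrightarrow>
        limitin sphere_topology (\<lambda>n. bracket (map a [0..<n + 1])) (?T v) sequentially"
    unfolding cfrac_has_value_def
    using limitin_sequentially_offset [of _ "\<lambda>n. bracket (map a [0..<n])" _ 1]
      limitin_sequentially_offset_rev [of _ "\<lambda>n. bracket (map a [0..<n])" 1] by blast
  also have "(\<lambda>n. bracket (map a [0..<n + 1])) =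
             (\<lambda>n. ?T (bracket (map (\<lambda>k. a (Suc k)) [0..<n])))"
    \<comment> \<open>The first entry must be split off; \<open>upt_Suc\<close> would split off the
      last one.\<close>
    by (simp add: map_upt_Suc del: upt_Suc)
  finally show ?thesis
    using limitin_moebius_iff [OF assms] by (simp add: cfrac_has_value_def)
qed

text \<open>The complex plane is Hausdorff and locally compact, so its one-point compactification is
  Hausdorff and the definite description picks the unique limit.\<close>

lemma cfrac_value_eqI:
  assumes "cfrac_has_value a v"
  shows "cfrac_value a = v"
proof -
  have "Hausdorff_space sphere_topology"
    by (simp add: Hausdorff_space_Alexandroff_compactification locally_compact_space_euclidean)
  then have "w = v" if "cfrac_has_value a w" for w
    using that assms unfolding cfrac_has_value_def
    by (metis limitin_Hausdorff_unique trivial_limit_sequentially)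
  with assms show ?thesis
    unfolding cfrac_value_def by (rule the_equality)
qed

lemma cfrac_convergent_Suc_iff:
  assumes "a 0 \<noteq> 0"
  shows "cfrac_convergent a \<longleftrightarrow> cfrac_convergent (\<lambda>k. a (Suc k))"
proof
  assume "cfrac_convergent a"
  then obtain v where "cfrac_has_value a v" by (auto simp: cfrac_convergent_def)
  \<comment> \<open>The limit is rewritten as the Moebius image of its preimage, to match the form
    in \<open>cfrac_has_value_Suc_iff\<close>.\<close>
  then have "cfrac_has_value a
      (sphere_divide (a 0) (sphere_add 1 (sphere_add (- 1) (sphere_divide (a 0) v))))"
    using assms by simp
  then show "cfrac_convergent (\<lambda>k. a (Suc k))"
    unfolding cfrac_has_value_Suc_iff [of a, OF assms] cfrac_convergent_def by blast
qed (use cfrac_has_value_Suc_iff [of a, OF assms] in \<open>auto simp: cfrac_convergent_def\<close>)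

text \<open>Convergence passes to the tail, so both values are genuine limits rather than
  unspecified.\<close>

lemma cfrac_value_Suc:
  assumes "a 0 \<noteq> 0" and "cfrac_convergent a"
  shows "cfrac_value a =
         sphere_divide (a 0) (sphere_add 1 (cfrac_value (\<lambda>k. a (Suc k))))"
proof -
  obtain v where v: "cfrac_has_value (\<lambda>k. a (Suc k)) v"
    using assms cfrac_convergent_Suc_iff [of a] by (auto simp: cfrac_convergent_def)
  then have "cfrac_has_value a (sphere_divide (a 0) (sphere_add 1 v))"
    using cfrac_has_value_Suc_iff [of a] assms(1) by blast
  with v show ?thesis by (simp add: cfrac_value_eqI)
qed

text \<open>The shift swaps parities: entry \<open>2 * n + 1\<close> carries the factor
  \<open>1 / \<sigma>\<close> times \<open>1 / (\<rho> * \<sigma>) ^ n\<close>, and entry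
  \<open>2 * n + 2\<close> that same factor times
  \<open>1 / (\<rho> * (\<rho> * \<sigma>) ^ n)\<close>. Hence \<open>\<sigma>\<close> and
  \<open>\<rho>\<close> trade places.\<close>

lemma g_entry_Suc: "g_entry z \<sigma> \<rho> (Suc k) = g_entry (z / of_real \<sigma>) \<rho> \<sigma> k"
  by (auto simp: g_entry_def mult_ac elim!: oddE)

theorem theorem6p1:
  fixes R C :: "nat \<Rightarrow> real" and \<sigma> \<rho> :: real and s :: complex
  assumes "fractal_cauer_RC R C \<sigma> \<rho>"
    and "s \<noteq> 0"
  shows "(g_convergent (Z (R 1) (C 1) s) \<sigma> \<rho> \<longleftrightarrow>
            g_convergent (Z (R 1) (C 1) (of_real \<sigma> * s)) \<rho> \<sigma>) \<and>
         (g_convergent (Z (R 1) (C 1) s) \<sigma> \<rho> \<longrightarrow>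
            g (Z (R 1) (C 1) s) \<sigma> \<rho> =
            sphere_divide (Z (R 1) (C 1) s)
              (sphere_add 1 (g (Z (R 1) (C 1) (of_real \<sigma> * s)) \<rho> \<sigma>)))"
proof -
  let ?z = "Z (R 1) (C 1) s"
  let ?a = "g_entry ?z \<sigma> \<rho>"
  \<comment> \<open>Positivity and \<open>s \<noteq> 0\<close> make the first entry nonzero, as
    invertibility of the Moebius map requires.\<close>
  have "R 1 > 0" "C 1 > 0"
    using assms(1) by (auto simp: fractal_cauer_RC_def)
  then have "?z \<noteq> 0" using assms(2) by (simp add: Z_def)
  moreover have a0: "?a 0 = ?z" by (simp add: g_entry_def)
  ultimately have nz: "?a 0 \<noteq> 0" by simp
  \<comment> \<open>\<open>Z\<close> is inversely proportional to \<open>s\<close>, so scaling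
    \<open>s\<close> by \<open>\<sigma>\<close> yields exactly the argument
    \<open>z / \<sigma>\<close> of the tail.\<close>
  have "Z (R 1) (C 1) (of_real \<sigma> * s) = ?z / of_real \<sigma>"
    by (simp add: Z_def)
  then have tail: "g_entry (Z (R 1) (C 1) (of_real \<sigma> * s)) \<rho> \<sigma> = (\<lambda>k. ?a (Suc k))"
    by (simp add: g_entry_Suc)
  show ?thesis
    unfolding g_convergent_def g_def tail
    using cfrac_convergent_Suc_iff [of ?a, OF nz] cfrac_value_Suc [of ?a, OF nz] a0 by simp
qed

end
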